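(* Let $X$ be a real normed space, $K \subseteq X$ and $f \in X \setminus K$. Suppose the minimum $$E:=\min_{q \in K} \|f-q\|$$ exists and $E > 0$. Let $\Psi : [0,\infty) \times (0,\infty) \to [0, \infty)$ be such that (i) for all $\delta \geq 0$, all $L \in (0,E]$ and all $p_1, p_2 \in K$ such that for all $i \in \{1,2\}$, $\|f-p_i\| \leq E+\Psi(\delta,L)$, we have that $\|p_1-p_2\|\leq \delta$; and (ii) for all $L \in (0,E]$, $\Psi(0,L)=0$. Put, for all $\delta > 0$, $\Psi^*(\delta):=\min\left(\frac\delta4, \Psi\left(\delta,\frac\delta4\right)\right)$, and put $\Psi^*(0):=0$. Then, for all $\delta \geq 0$ and all $p_1, p_2 \in K$ such that for all $i \in \{1,2\}$, $\|f-p_i\| \leq E+\Psi^*(\delta)$, we have that $\|p_1-p_2\|\leq \delta$. *)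

theory Defs
  imports "HOL-Analysis.Analysis"
begin

text \<open>The domain of the modulus \<open>\<Psi>\<close> is \<open>[0,\<infinity>) \<times> (0,\<infinity>)\<close> and that of \<open>\<Psi>\<^sup>*\<close> is \<open>[0,\<infinity>)\<close>;
  both are total functions here. On \<open>\<delta> \<ge> 0\<close>, \<open>Psi_star\<close> reads \<open>\<Psi>\<close> only inside its domain,
  and its value for \<open>\<delta> < 0\<close> is irrelevant.\<close>

definition Psi_star :: "(real \<Rightarrow> real \<Rightarrow> real) \<Rightarrow> real \<Rightarrow> real" where
  "Psi_star \<Psi> \<delta> = (if \<delta> > 0 then min (\<delta> / 4) (\<Psi> \<delta> (\<delta> / 4)) else 0)"

end

theory Submission
  imports Defs
begin

text \<open>
  The term \<open>\<delta> / 4\<close> in the minimum defining \<open>Psi_star\<close> removes the restriction \<open>L \<le> E\<close>.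
  If \<open>\<delta> / 4 \<le> E\<close>, then \<open>L = \<delta> / 4\<close> is an admissible second argument of \<open>\<Psi>\<close> and the
  bound \<open>Psi_star \<Psi> \<delta> \<le> \<Psi> \<delta> (\<delta> / 4)\<close> reduces the claim to the property of \<open>\<Psi>\<close>.
  If \<open>E < \<delta> / 4\<close>, the modulus carries no information, but the other bound
  \<open>Psi_star \<Psi> \<delta> \<le> \<delta> / 4\<close> puts both points within \<open>\<delta> / 2\<close> of \<open>f\<close>, and the triangle
  inequality suffices. For \<open>\<delta> = 0\<close> both points are best approximations of \<open>f\<close>, whose
  uniqueness is the property of \<open>\<Psi>\<close> at \<open>\<delta> = 0\<close>, where \<open>\<Psi>\<close> vanishes.
\<close>

theorem proposition4p3:
  fixes K :: "'a::real_normed_vector set" and f :: 'a and E :: real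
    and \<Psi> :: "real \<Rightarrow> real \<Rightarrow> real"
  assumes f_notin: "f \<notin> K"
    and E_attained: "\<exists>q\<in>K. norm (f - q) = E"
    and E_lower: "\<forall>q\<in>K. E \<le> norm (f - q)"
    and E_pos: "E > 0"
    and Psi_nonneg: "\<forall>\<delta>\<ge>0. \<forall>L>0. \<Psi> \<delta> L \<ge> 0"
    and Psi_i: "\<forall>\<delta>\<ge>0. \<forall>L\<in>{0<..E}. \<forall>p1\<in>K. \<forall>p2\<in>K.
        norm (f - p1) \<le> E + \<Psi> \<delta> L \<and> norm (f - p2) \<le> E + \<Psi> \<delta> L
        \<longrightarrow> norm (p1 - p2) \<le> \<delta>"
    and Psi_ii: "\<forall>L\<in>{0<..E}. \<Psi> 0 L = 0"
  shows "\<forall>\<delta>\<ge>0. \<forall>p1\<in>K. \<forall>p2\<in>K.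
        norm (f - p1) \<le> E + Psi_star \<Psi> \<delta> \<and> norm (f - p2) \<le> E + Psi_star \<Psi> \<delta>
        \<longrightarrow> norm (p1 - p2) \<le> \<delta>"
proof (intro allI ballI impI, elim conjE)
  fix \<delta> :: real and p1 p2
  assume "\<delta> \<ge> 0" and K: "p1 \<in> K" "p2 \<in> K"
    and near: "norm (f - p1) \<le> E + Psi_star \<Psi> \<delta>" "norm (f - p2) \<le> E + Psi_star \<Psi> \<delta>"
  consider "\<delta> = 0" | "0 < \<delta>" "\<delta> / 4 \<le> E" | "0 < \<delta>" "E < \<delta> / 4"
    using \<open>\<delta> \<ge> 0\<close> by linarith
  then show "norm (p1 - p2) \<le> \<delta>"
  proof cases
    case 1
    have "E \<in> {0<..E}"
      using E_pos by simp
    moreover from this have "Psi_star \<Psi> 0 = \<Psi> 0 E"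
      using Psi_ii by (simp add: Psi_star_def)
    ultimately show ?thesis
      using Psi_i K near \<open>\<delta> \<ge> 0\<close> 1 by metis
  next
    case 2
    then have "\<delta> / 4 \<in> {0<..E}" and "Psi_star \<Psi> \<delta> \<le> \<Psi> \<delta> (\<delta> / 4)"
      by (simp_all add: Psi_star_def)
    moreover from this(2) have "norm (f - p1) \<le> E + \<Psi> \<delta> (\<delta> / 4)" "norm (f - p2) \<le> E + \<Psi> \<delta> (\<delta> / 4)"
      using near by linarith+
    ultimately show ?thesis
      using Psi_i K \<open>\<delta> \<ge> 0\<close> by blast
  next
    case 3
    then have "Psi_star \<Psi> \<delta> \<le> \<delta> / 4"
      by (simp add: Psi_star_def)
    then have "norm (f - p1) \<le> \<delta> / 2" "norm (f - p2) \<le> \<delta> / 2"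
      using near 3 by linarith+
    moreover have "norm (p1 - p2) \<le> norm (f - p1) + norm (f - p2)"
      using norm_triangle_ineq4[of "f - p2" "f - p1"] by simp
    ultimately show ?thesis
      by linarith
  qed
qed

end
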